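(* Let $n\ge 2$ and let $X_1,\dots,X_n$ be independent real random variables, where $X_i$ has the law $P_{\theta_i^\star}$ of a regular one-parameter exponential family $\{P_\theta\}_{\theta\in\Theta}$ (the same family for all $i$) with parameter $\theta_i^\star\in\Theta$; put $\mu_i^\star=\mathbb{E}[X_i]=b'(\theta_i^\star)$. Let $\pi^\star$ be a permutation of $\{1,\dots,n\}$ with $\mu^\star_{\pi^\star(1)}\ge\cdots\ge\mu^\star_{\pi^\star(n)}$. Fix positive integers $n_1,\dots,n_p$ with $n_1+\cdots+n_p=n$. For a coarse ranking $\boldsymbol I=(I_1,\dots,I_p)$ of size $(n_1,\dots,n_p)$, let $\widehat{\boldsymbol\mu}^{\boldsymbol I}$ be the unique minimizer of $$\sum_{i=1}^n (X_i-\mu_i)^2\quad\text{subject to}\quad \boldsymbol\mu_{I_1}\ge\boldsymbol\mu_{I_2}\ge\cdots\ge\boldsymbol\mu_{I_p}.$$ Let $U:\mathbb{R}\to\mathbb{R}$ be nondecreasing and convex, and set $\mathsf{Util}(\boldsymbol I)=\mathbb{E}\big[\sum_{i=1}^n U(\widehat\mu_i^{\boldsymbol I})\big]$. Let $\boldsymbol I^\star=(I_1^\star,\dots,I_p^\star)$ with $$I_j^\star=\Big\{\pi^\star(i):\ 1+\sum_{k=1}^{j-1}n_k\le i\le\sum_{k=1}^{j}n_k\Big\},\qquad j=1,\dots,p.$$ Then $\mathsf{Util}(\boldsymbol I^\star)\ge\mathsf{Util}(\boldsymbol I)$ for every coarse ranking $\boldsymbol I$ of size $(n_1,\dots,n_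p)$.
   Context: Regular one-parameter exponential family: there are a base measure $\rho$ on $\mathbb{R}$, a carrier function $c\ge 0$, an open interval $\Theta\subseteq\mathbb{R}$, and a log-partition function $b:\Theta\to\mathbb{R}$ such that for each $\theta\in\Theta$, $P_\theta$ has density $p_\theta(x)=e^{\theta x-b(\theta)}c(x)$ with respect to $\rho$; $b$ is twice differentiable with $b''(\theta)>0$ on $\Theta$. One has $\mathbb{E}_\theta[X]=b'(\theta)$ and $\mathrm{Var}_\theta(X)=b''(\theta)\in(0,\infty)$. A coarse ranking of size $(n_1,\dots,n_p)$ is an ordered partition $\boldsymbol I=(I_1,\dots,I_p)$ of $\{1,\dots,n\}$ with $|I_j|=n_j$. For $\boldsymbol a\in\mathbb{R}^n$, the notation $\boldsymbol a_{I_1}\ge\cdots\ge\boldsymbol a_{I_p}$ means that $a_s\ge a_t$ whenever $s\in I_i$, $t\in I_j$ with $1\le i<j\le p$ (no constraint within a block). Since a nondecreasing convex $U$ is bounded below by an affine function and the $X_i$ are integrable, the expectations defining $\mathsf{Util}$ are well defined in $(-\infty,+\infty]$. *)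

theory Defs
  imports "HOL-Probability.Probability" "HOL-Combinatorics.Permutations"
begin

section \<open>Regular one-parameter exponential families\<close>

definition exp_family_law ::
  "real measure \<Rightarrow> (real \<Rightarrow> real) \<Rightarrow> (real \<Rightarrow> real) \<Rightarrow> real \<Rightarrow> real measure" where
  "exp_family_law \<rho> c b \<theta> = density \<rho> (\<lambda>x. ennreal (exp (\<theta> * x - b \<theta>) * c x))"

text \<open>
  The base measure is not required to be sigma-finite. The identities for the mean and the
  variance in terms of \<^term>\<open>b\<close> are consequences, not part of the definition; for the mean see
  \<open>exp_family_law_mean\<close> below.
\<close>

locale regular_exp_family =
  fixes \<rho> :: "real measure" and c :: "real \<Rightarrow> real" and \<Theta> :: "real set" and b :: "real \<Rightarrow> real"
  assumes sets_base: "sets \<rho> = sets borel"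
    and carrier_measurable: "c \<in> borel_measurable borel"
    and carrier_nonneg: "\<And>x. 0 \<le> c x"
    and params_open: "open \<Theta>"
    and params_interval: "is_interval \<Theta>"
    and params_nonempty: "\<Theta> \<noteq> {}"
    and prob_law: "\<And>\<theta>. \<theta> \<in> \<Theta> \<Longrightarrow> prob_space (exp_family_law \<rho> c b \<theta>)"
    and logpart_differentiable: "\<And>\<theta>. \<theta> \<in> \<Theta> \<Longrightarrow> b differentiable (at \<theta>)"
    and logpart_deriv_differentiable: "\<And>\<theta>. \<theta> \<in> \<Theta> \<Longrightarrow> deriv b differentiable (at \<theta>)"
    and logpart_deriv2_pos: "\<And>\<theta>. \<theta> \<in> \<Theta> \<Longrightarrow> 0 < deriv (deriv b) \<theta>"


section \<open>Coarse rankings\<close>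

definition coarse_ranking ::
  "nat \<Rightarrow> nat \<Rightarrow> (nat \<Rightarrow> nat) \<Rightarrow> (nat \<Rightarrow> nat set) \<Rightarrow> bool" where
  "coarse_ranking n p ns I \<longleftrightarrow>
     (\<Union>j\<in>{1..p}. I j) = {1..n} \<and> disjoint_family_on I {1..p} \<and> (\<forall>j\<in>{1..p}. card (I j) = ns j)"

definition block_decreasing :: "nat \<Rightarrow> (nat \<Rightarrow> nat set) \<Rightarrow> (nat \<Rightarrow> real) \<Rightarrow> bool" where
  "block_decreasing p I a \<longleftrightarrow>
     (\<forall>i\<in>{1..p}. \<forall>j\<in>{1..p}. i < j \<longrightarrow> (\<forall>s\<in>I i. \<forall>t\<in>I j. a s \<ge> a t))"

definition consecutive_blocks ::
  "(nat \<Rightarrow> nat) \<Rightarrow> (nat \<Rightarrow> nat) \<Rightarrow> nat \<Rightarrow> nat set" where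
  "consecutive_blocks ns \<pi> j = {\<pi> i |i. 1 + (\<Sum>k=1..j-1. ns k) \<le> i \<and> i \<le> (\<Sum>k=1..j. ns k)}"


section \<open>Constrained least squares and expected utility\<close>

text \<open>
  A vector indexed by \<open>{1..n}\<close> is a function in \<^term>\<open>extensional {1..n}\<close>, so that
  it is determined by its values on the index set and the minimizer is literally unique.
\<close>

definition is_constrained_lse ::
  "nat \<Rightarrow> nat \<Rightarrow> (nat \<Rightarrow> nat set) \<Rightarrow> (nat \<Rightarrow> real) \<Rightarrow> (nat \<Rightarrow> real) \<Rightarrow> bool" where
  "is_constrained_lse n p I x =
     is_arg_min (\<lambda>\<mu>. \<Sum>i=1..n. (x i - \<mu> i)\<^sup>2)
                (\<lambda>\<mu>. \<mu> \<in> extensional {1..n} \<and> block_decreasing p I \<mu>)"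

definition constrained_lse ::
  "nat \<Rightarrow> nat \<Rightarrow> (nat \<Rightarrow> nat set) \<Rightarrow> (nat \<Rightarrow> real) \<Rightarrow> nat \<Rightarrow> real" where
  "constrained_lse n p I x = (THE \<mu>. is_constrained_lse n p I x \<mu>)"

text \<open>
  Expectation with values in the extended reals. It is meaningful when the positive or the
  negative part of \<^term>\<open>f\<close> is integrable (the difference of two infinities is a
  default value); for the utilities below the negative part is integrable.
\<close>

definition ext_expectation :: "'a measure \<Rightarrow> ('a \<Rightarrow> real) \<Rightarrow> ereal" where
  "ext_expectation M f =
     enn2ereal (\<integral>\<^sup>+ \<omega>. ennreal (f \<omega>) \<partial>M) - enn2ereal (\<integral>\<^sup>+ \<omega>. ennreal (- f \<omega>) \<partial>M)"

definition Util ::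
  "'a measure \<Rightarrow> nat \<Rightarrow> nat \<Rightarrow> (nat \<Rightarrow> 'a \<Rightarrow> real) \<Rightarrow> (real \<Rightarrow> real) \<Rightarrow> (nat \<Rightarrow> nat set) \<Rightarrow> ereal" where
  "Util M n p X U I =
     ext_expectation M (\<lambda>\<omega>. \<Sum>i=1..n. U (constrained_lse n p I (\<lambda>i. X i \<omega>) i))"


section \<open>Well-definedness\<close>

lemma ex1_constrained_lse:
  assumes "coarse_ranking n p ns I"
  shows "\<exists>!\<mu>. is_constrained_lse n p I x \<mu>"
proof -
  let ?A = "{1..n}"
  define f where "f = (\<lambda>\<mu>::nat\<Rightarrow>real. \<Sum>i=1..n. (x i - \<mu> i)\<^sup>2)"
  define F where "F = {\<mu>. \<mu> \<in> extensional ?A \<and> block_decreasing p I \<mu>}"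
  have sub: "s \<in> ?A" if "j \<in> {1..p}" "s \<in> I j" for s j
    using assms that unfolding coarse_ranking_def by blast
  define z where "z = restrict (\<lambda>_. 0::real) ?A"
  have zF: "z \<in> F"
    using sub by (auto simp: F_def z_def block_decreasing_def)
  define R where "R = (\<Sum>i=1..n. \<bar>x i\<bar>) + sqrt (f z)"
  have fnn: "f \<mu> \<ge> 0" for \<mu> by (simp add: f_def sum_nonneg)
  have Rb: "\<bar>\<mu> i\<bar> \<le> R" if "f \<mu> \<le> f z" "i \<in> ?A" for \<mu> i
  proof -
    have "(x i - \<mu> i)\<^sup>2 \<le> f \<mu>"
      unfolding f_def using that by (intro member_le_sum) auto
    then have "\<bar>x i - \<mu> i\<bar> \<le> sqrt (f z)"
      using that by (metis order.trans real_sqrt_abs real_sqrt_le_iff)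
    moreover have "\<bar>x i\<bar> \<le> (\<Sum>i=1..n. \<bar>x i\<bar>)"
      using that by (intro member_le_sum) auto
    ultimately show ?thesis by (simp add: R_def)
  qed
  define K where "K = PiE UNIV (\<lambda>i. if i \<in> ?A then {-R..R} else {undefined::real})"
  have cK: "compact K"
    unfolding K_def compactin_euclidean_iff[symmetric] euclidean_product_topology[symmetric]
    by (subst compactin_PiE) (auto simp: compactin_euclidean_iff)
  have co: "continuous_on S (\<lambda>\<mu>::nat\<Rightarrow>real. \<mu> i)" for S i
    by (rule continuous_on_subset[OF continuous_on_product_coordinates]) auto
  have clB: "closed {\<mu>. block_decreasing p I \<mu>}"
  proof -
    have "{\<mu>. block_decreasing p I \<mu>} =
        (\<Inter>i\<in>{1..p}. \<Inter>j\<in>{j\<in>{1..p}. i < j}. \<Inter>s\<in>I i. \<Inter>t\<in>I j. {\<mu>. \<mu> t \<le> \<mu> s})"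
      unfolding block_decreasing_def by blast
    moreover have "closed {\<mu>::nat\<Rightarrow>real. \<mu> t \<le> \<mu> s}" for s t
      by (intro closed_Collect_le co)
    ultimately show ?thesis by (auto intro!: closed_INT)
  qed
  have cFK: "compact (K \<inter> {\<mu>. block_decreasing p I \<mu>})"
    using cK clB by (rule compact_Int_closed)
  have inK: "\<mu> \<in> K" if "\<mu> \<in> F" "f \<mu> \<le> f z" for \<mu>
    using that Rb[of \<mu>] unfolding K_def F_def
    by (auto simp: extensional_def abs_le_iff PiE_def Pi_iff minus_le_iff)
  have KF: "K \<inter> {\<mu>. block_decreasing p I \<mu>} \<subseteq> F"
  proof
    fix \<mu> assume *: "\<mu> \<in> K \<inter> {\<mu>. block_decreasing p I \<mu>}"
    have "\<mu> i = undefined" if "i \<notin> ?A" for i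
    proof -
      have "\<mu> i \<in> (if i \<in> ?A then {-R..R} else {undefined})"
        using * unfolding K_def by blast
      then show ?thesis using that by (simp only: if_False singleton_iff)
    qed
    then show "\<mu> \<in> F" using * by (auto simp only: F_def extensional_def)
  qed
  have "continuous_on (K \<inter> {\<mu>. block_decreasing p I \<mu>}) f"
    unfolding f_def by (intro continuous_intros co)
  moreover have zK: "z \<in> K \<inter> {\<mu>. block_decreasing p I \<mu>}"
    using inK[OF zF] zF by (auto simp: F_def)
  ultimately obtain m where m: "m \<in> K \<inter> {\<mu>. block_decreasing p I \<mu>}"
    and mmin: "\<And>y. y \<in> K \<inter> {\<mu>. block_decreasing p I \<mu>} \<Longrightarrow> f m \<le> f y"
    using continuous_attains_inf[OF cFK] by blast
  have mF: "m \<in> F" using m KF by blast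
  have mle: "f m \<le> f y" if "y \<in> F" for y
  proof (cases "f y \<le> f z")
    case True
    then show ?thesis using inK[OF that True] that mmin by (auto simp: F_def)
  next
    case False
    then show ?thesis using mmin[OF zK] by linarith
  qed
  have iff: "is_constrained_lse n p I x \<mu> \<longleftrightarrow> \<mu> \<in> F \<and> (\<forall>y\<in>F. f \<mu> \<le> f y)" for \<mu>
    unfolding is_constrained_lse_def is_arg_min_linorder F_def f_def by auto
  have uniq: "u = v" if u: "u \<in> F" "\<forall>y\<in>F. f u \<le> f y" and v: "v \<in> F" "\<forall>y\<in>F. f v \<le> f y" for u v
  proof -
    define w where "w = restrict (\<lambda>i. (u i + v i) / 2) ?A"
    have "w t \<le> w s" if ij: "i \<in> {1..p}" "j \<in> {1..p}" "i < j" "s \<in> I i" "t \<in> I j" for i j s t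
    proof -
      have "u t \<le> u s" "v t \<le> v s"
        using u(1) v(1) ij unfolding F_def block_decreasing_def by blast+
      then show ?thesis
        using sub[OF ij(1,4)] sub[OF ij(2,5)] by (simp add: w_def)
    qed
    then have "w \<in> F"
      unfolding F_def block_decreasing_def w_def by blast
    then have "f u \<le> f w" "f v \<le> f w" using u v by auto
    moreover have "f w = (f u + f v) / 2 - (\<Sum>i=1..n. (u i - v i)\<^sup>2) / 4"
    proof -
      have "f w = (\<Sum>i=1..n. ((x i - u i)\<^sup>2 + (x i - v i)\<^sup>2) / 2 - (u i - v i)\<^sup>2 / 4)"
        unfolding f_def w_def by (intro sum.cong) (auto simp: power2_eq_square field_simps)
      then show ?thesis
        by (simp add: f_def sum_subtractf sum.distrib sum_divide_distrib[symmetric])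
    qed
    moreover have "(\<Sum>i=1..n. (u i - v i)\<^sup>2) \<ge> 0" by (intro sum_nonneg) auto
    ultimately have "(\<Sum>i=1..n. (u i - v i)\<^sup>2) = 0" by argo
    then have "\<forall>i\<in>?A. u i = v i" by (subst (asm) sum_nonneg_eq_0_iff) auto
    then show ?thesis using u(1) v(1) unfolding F_def by (auto intro: extensionalityI)
  qed
  show ?thesis unfolding iff using mF mle uniq by blast
qed

lemma coarse_ranking_consecutive_blocks:
  assumes "\<pi> permutes {1..n}" and "(\<Sum>j=1..p. ns j) = n"
  shows "coarse_ranking n p ns (consecutive_blocks ns \<pi>)"
proof -
  define S where "S j = (\<Sum>k=1..j. ns k)" for j
  have mono: "S i \<le> S j" if "i \<le> j" for i j
    unfolding S_def using that by (intro sum_mono2) auto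
  have step: "S j = S (j - 1) + ns j" if "j \<ge> 1" for j
    using that by (cases j) (auto simp: S_def)
  have blk: "consecutive_blocks ns \<pi> j = \<pi> ` {S (j - 1)<..S j}" for j
    by (auto simp: consecutive_blocks_def S_def Suc_le_eq)
  have inj: "inj \<pi>" using assms(1) by (rule permutes_inj)
  have S0: "S 0 = 0" by (simp add: S_def)
  have un: "(\<Union>j\<in>{1..q}. {S (j - 1)<..S j}) = {0<..S q}" for q
  proof (induction q)
    case (Suc q)
    have "(\<Union>j\<in>{1..Suc q}. {S (j - 1)<..S j}) = {0<..S q} \<union> {S q<..S (Suc q)}"
      using Suc by (simp add: atLeastAtMostSuc_conv Un_commute)
    then show ?case using mono[of q "Suc q"] by (auto simp: not_less)
  qed (simp add: S0)
  have "(\<Union>j\<in>{1..p}. consecutive_blocks ns \<pi> j) = \<pi> ` {0<..S p}"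
    unfolding blk un[symmetric] by blast
  also have "{0<..S p} = {1..n}" using assms(2) by (auto simp: S_def)
  also have "\<pi> ` {1..n} = {1..n}" using assms(1) by (rule permutes_image)
  finally have 1: "(\<Union>j\<in>{1..p}. consecutive_blocks ns \<pi> j) = {1..n}" .
  have dis: "consecutive_blocks ns \<pi> i \<inter> consecutive_blocks ns \<pi> j = {}" if "i < j" for i j
  proof -
    have "{S (i - 1)<..S i} \<inter> {S (j - 1)<..S j} = {}"
    proof -
      have "S i \<le> S (j - 1)" using that by (intro mono) simp
      then show ?thesis by auto
    qed
    then show ?thesis unfolding blk image_Int[OF inj, symmetric] by simp
  qed
  then have 2: "disjoint_family_on (consecutive_blocks ns \<pi>) {1..p}"
    unfolding disjoint_family_on_def by (metis Int_commute linorder_neqE_nat)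
  have 3: "card (consecutive_blocks ns \<pi> j) = ns j" if "j \<in> {1..p}" for j
    using that step[of j] unfolding blk
    by (subst card_image) (auto intro: inj_on_subset[OF inj])
  show ?thesis unfolding coarse_ranking_def using 1 2 3 by blast
qed

lemma (in regular_exp_family) exp_family_law_mean:
  assumes \<theta>: "\<theta> \<in> \<Theta>"
  shows "integrable (exp_family_law \<rho> c b \<theta>) (\<lambda>x. x)"
    and "(\<integral>x. x \<partial>exp_family_law \<rho> c b \<theta>) = deriv b \<theta>"
proof -
  let ?P = "exp_family_law \<rho> c b \<theta>"
  interpret P: prob_space ?P by (rule prob_law[OF \<theta>])
  have cm [measurable]: "c \<in> borel_measurable \<rho>"
    using carrier_measurable measurable_cong_sets[OF sets_base refl] by blast
  have idm [measurable]: "(\<lambda>x. x) \<in> borel_measurable \<rho>"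
    by (rule measurable_ident_sets[OF sets_base])
  have setsP: "sets ?P = sets borel"
    by (simp add: exp_family_law_def sets_base)
  have idP [measurable]: "(\<lambda>x. x) \<in> borel_measurable ?P"
    by (rule measurable_ident_sets[OF setsP])
  have mgf: "(\<integral>\<^sup>+ x. ennreal (exp (h * x)) \<partial>?P) = ennreal (exp (b (\<theta> + h) - b \<theta>))"
    if "\<theta> + h \<in> \<Theta>" for h
  proof -
    interpret Q: prob_space "exp_family_law \<rho> c b (\<theta> + h)" by (rule prob_law[OF that])
    have "(\<integral>\<^sup>+ x. ennreal (exp (h * x)) \<partial>?P)
        = (\<integral>\<^sup>+ x. ennreal (exp (\<theta> * x - b \<theta>) * c x) * ennreal (exp (h * x)) \<partial>\<rho>)"
      unfolding exp_family_law_def by (subst nn_integral_density) auto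
    also have "\<dots> = (\<integral>\<^sup>+ x. ennreal (exp (b (\<theta> + h) - b \<theta>)) *
                   ennreal (exp ((\<theta> + h) * x - b (\<theta> + h)) * c x) \<partial>\<rho>)"
    proof (intro nn_integral_cong)
      fix x
      have "exp (\<theta> * x - b \<theta>) * exp (h * x)
          = exp (b (\<theta> + h) - b \<theta>) * exp ((\<theta> + h) * x - b (\<theta> + h))"
        by (simp add: exp_add[symmetric] ring_distribs)
      then have "exp (\<theta> * x - b \<theta>) * c x * exp (h * x)
          = exp (b (\<theta> + h) - b \<theta>) * (exp ((\<theta> + h) * x - b (\<theta> + h)) * c x)"
        by (metis mult.assoc mult.commute)
      then show "ennreal (exp (\<theta> * x - b \<theta>) * c x) * ennreal (exp (h * x))
          = ennreal (exp (b (\<theta> + h) - b \<theta>)) *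
            ennreal (exp ((\<theta> + h) * x - b (\<theta> + h)) * c x)"
        by (simp add: ennreal_mult[symmetric] carrier_nonneg)
    qed
    also have "\<dots> = ennreal (exp (b (\<theta> + h) - b \<theta>)) *
                   (\<integral>\<^sup>+ x. ennreal (exp ((\<theta> + h) * x - b (\<theta> + h)) * c x) \<partial>\<rho>)"
      by (subst nn_integral_cmult) auto
    also have "(\<integral>\<^sup>+ x. ennreal (exp ((\<theta> + h) * x - b (\<theta> + h)) * c x) \<partial>\<rho>)
        = emeasure (exp_family_law \<rho> c b (\<theta> + h)) (space (exp_family_law \<rho> c b (\<theta> + h)))"
      unfolding exp_family_law_def by (subst emeasure_density) (auto intro!: nn_integral_cong)
    finally show ?thesis by (simp add: Q.emeasure_space_1)
  qed
  have ie: "integrable ?P (\<lambda>x. exp (h * x))"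
    and ee: "(\<integral>x. exp (h * x) \<partial>?P) = exp (b (\<theta> + h) - b \<theta>)" if "\<theta> + h \<in> \<Theta>" for h
  proof -
    have "has_bochner_integral ?P (\<lambda>x. exp (h * x)) (exp (b (\<theta> + h) - b \<theta>))"
      by (rule has_bochner_integral_nn_integral) (use mgf[OF that] in auto)
    then show "integrable ?P (\<lambda>x. exp (h * x))"
      "(\<integral>x. exp (h * x) \<partial>?P) = exp (b (\<theta> + h) - b \<theta>)"
      by (auto simp: has_bochner_integral_iff)
  qed
  obtain e where e: "e > 0" "ball \<theta> e \<subseteq> \<Theta>"
    using params_open \<theta> open_contains_ball by blast
  have inT: "\<theta> + h \<in> \<Theta>" if "\<bar>h\<bar> < e" for h
    using e that by (auto simp: dist_real_def)
  define h where "h = e / 2"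
  have h: "h > 0" "\<bar>h\<bar> < e" "\<bar>-h\<bar> < e" using e by (auto simp: h_def)
  show int: "integrable ?P (\<lambda>x. x)"
  proof (rule Bochner_Integration.integrable_bound)
    show "integrable ?P (\<lambda>x. (exp (h * x) + exp (- h * x)) / h)"
      using ie[OF inT[OF h(2)]] ie[OF inT[OF h(3)]] by auto
    show "AE x in ?P. norm x \<le> norm ((exp (h * x) + exp (- h * x)) / h)"
    proof (rule AE_I2)
      fix x :: real
      have "h * \<bar>x\<bar> \<le> exp (h * x) + exp (- h * x)"
      proof -
        have "1 + h * x \<le> exp (h * x)" "1 + - h * x \<le> exp (- h * x)"
          "0 < exp (h * x)" "0 < exp (- h * x)"
          by (rule exp_ge_add_one_self exp_gt_zero)+
        then have "h * x \<le> exp (h * x) + exp (- h * x)"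
          "- h * x \<le> exp (h * x) + exp (- h * x)"
          by linarith+
        then show ?thesis by (cases "x \<ge> 0") simp_all
      qed
      then show "norm x \<le> norm ((exp (h * x) + exp (- h * x)) / h)"
        using h(1) by (simp add: field_simps)
    qed
  qed (rule idP)
  let ?m = "\<integral>x. x \<partial>?P"
  define g where "g = (\<lambda>h. exp (b (\<theta> + h) - b \<theta>) - 1 - h * ?m)"
  have g_nonneg: "g h \<ge> 0" if "\<bar>h\<bar> < e" for h
  proof -
    have "(\<integral>x. 1 + h * x \<partial>?P) \<le> (\<integral>x. exp (h * x) \<partial>?P)"
      by (intro integral_mono Bochner_Integration.integrable_add integrable_mult_right int
            ie inT that) (auto simp: exp_ge_add_one_self)
    then show ?thesis
      using int P.prob_space by (simp add: g_def ee inT that)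
  qed
  have bd: "(b has_real_derivative deriv b \<theta>) (at \<theta>)"
    using logpart_differentiable[OF \<theta>] by (simp add: DERIV_deriv_iff_real_differentiable)
  then have bd0: "((\<lambda>h. b (\<theta> + h)) has_real_derivative deriv b \<theta>) (at 0)"
    using DERIV_shift[of b "deriv b \<theta>" 0 \<theta>] by (simp add: add.commute)
  have "(g has_real_derivative (deriv b \<theta> - ?m)) (at 0)"
    unfolding g_def by (auto intro!: derivative_eq_intros bd0)
  then have "deriv b \<theta> - ?m = 0"
    by (rule DERIV_local_min[where d = e]) (use e g_nonneg in \<open>auto simp: g_def\<close>)
  then show "?m = deriv b \<theta>" by simp
qed

end

theory Submission
  imports Defs
begin

text \<open>
  Suppose \<open>s\<close> lies in a better block than \<open>t\<close> although \<open>\<mu> s \<le> \<mu> t\<close>. Exchanging the two indices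
  does not decrease the expected utility, and finitely many such exchanges lead to the
  optimal ranking.

  Pathwise, let \<open>m\<close> be the projection of \<open>x\<close> onto the cone \<open>K\<close> of block-decreasing vectors.
  If \<open>g\<close> is a monotone selection of subgradients of \<open>U\<close>, then \<open>g \<circ> m\<close> lies in \<open>K\<close> and is
  orthogonal to \<open>x - m\<close>, because \<open>m - \<epsilon> (g \<circ> m)\<close> stays in \<open>K\<close> for small \<open>\<epsilon>\<close>. Hence adding an
  element of the polar cone of \<open>K\<close> to \<open>x\<close> cannot increase \<open>\<Sum>i. U (m i)\<close>. If \<open>x s \<ge> x t\<close>,
  exchanging the values at \<open>s\<close> and \<open>t\<close> adds the polar vector \<open>(x s - x t) (e\<^sub>t - e\<^sub>s)\<close>.

  In distribution, the joint law has the density \<open>L (x t)\<close>, where \<open>L\<close> is increasing (monotone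
  likelihood ratio), with respect to the product measure in which the law of \<open>X t\<close> is replaced
  by that of \<open>X s\<close>. This reference measure is invariant under the exchange, so that the
  pathwise inequality and the rearrangement inequality for two pairs combine under the integral.
\<close>

section \<open>Projection onto the cone of block-decreasing vectors\<close>

lemma coarse_ranking_subset:
  assumes "coarse_ranking n p ns I" "j \<in> {1..p}" "s \<in> I j"
  shows "s \<in> {1..n}"
  using assms unfolding coarse_ranking_def by blast

lemma is_constrained_lse_constrained_lse:
  assumes "coarse_ranking n p ns I"
  shows "is_constrained_lse n p I x (constrained_lse n p I x)"
  unfolding constrained_lse_def by (rule theI'[OF ex1_constrained_lse[OF assms]])

lemma constrained_lse_eqI:
  assumes "coarse_ranking n p ns I" "is_constrained_lse n p I x m"
  shows "constrained_lse n p I x = m"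
  using ex1_constrained_lse[OF assms(1)] is_constrained_lse_constrained_lse[OF assms(1)] assms(2) by blast

lemma is_constrained_lse_iff:
  "is_constrained_lse n p I x m \<longleftrightarrow> m \<in> extensional {1..n} \<and> block_decreasing p I m \<and>
     (\<forall>y. y \<in> extensional {1..n} \<longrightarrow> block_decreasing p I y \<longrightarrow>
        (\<Sum>i=1..n. (x i - m i)\<^sup>2) \<le> (\<Sum>i=1..n. (x i - y i)\<^sup>2))"
  unfolding is_constrained_lse_def is_arg_min_linorder by auto

lemma block_decreasing_constrained_lse:
  assumes "coarse_ranking n p ns I"
  shows "block_decreasing p I (constrained_lse n p I x)"
  using is_constrained_lse_constrained_lse[OF assms] by (simp add: is_constrained_lse_iff)

text \<open>First-order optimality: moving from \<open>m\<close> by a fraction \<open>d\<close>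
  towards a feasible \<open>w\<close> stays feasible, and a positive inner product would let this
  move lower the objective.\<close>

lemma constrained_lse_variational:
  fixes x :: "nat \<Rightarrow> real"
  assumes I: "coarse_ranking n p ns I" and w: "block_decreasing p I w"
  defines "m \<equiv> constrained_lse n p I x"
  shows "(\<Sum>i=1..n. (x i - m i) * (w i - m i)) \<le> 0"
proof (rule ccontr)
  define A where "A = (\<Sum>i=1..n. (x i - m i) * (w i - m i))"
  define B where "B = (\<Sum>i=1..n. (w i - m i)\<^sup>2)"
  assume "\<not> (\<Sum>i=1..n. (x i - m i) * (w i - m i)) \<le> 0"
  then have A: "A > 0" by (simp add: A_def)
  have B: "B \<ge> 0" by (simp add: B_def sum_nonneg)
  \<comment> \<open>The move changes the objective by \<open>d\<^sup>2 * B - 2 * d * A\<close>, so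
    any positive \<open>d\<close> with \<open>d * B < 2 * A\<close> is contradictory. The
    denominator \<open>B + 1\<close> covers \<open>B = 0\<close>, and \<open>d \<le> 1\<close> keeps
    the combination convex.\<close>
  define d where "d = min 1 (A / (B + 1))"
  have d: "0 < d" "d \<le> 1" "d \<le> A / (B + 1)" using A B by (auto simp: d_def)
  define y where "y = restrict (\<lambda>i. (1 - d) * m i + d * w i) {1..n}"
  have lse: "is_constrained_lse n p I x m"
    unfolding m_def by (rule is_constrained_lse_constrained_lse[OF I])
  have "y t \<le> y s" if ij: "i \<in> {1..p}" "j \<in> {1..p}" "i < j" "s \<in> I i" "t \<in> I j" for i j s t
  proof -
    have "m t \<le> m s" "w t \<le> w s"
      using lse w ij unfolding is_constrained_lse_iff block_decreasing_def by blast+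
    then have "(1 - d) * m t + d * w t \<le> (1 - d) * m s + d * w s"
      using d by (intro add_mono mult_left_mono) auto
    then show ?thesis
      using coarse_ranking_subset[OF I ij(1,4)] coarse_ranking_subset[OF I ij(2,5)]
      by (simp add: y_def)
  qed
  then have "block_decreasing p I y" unfolding block_decreasing_def by blast
  moreover have "y \<in> extensional {1..n}" by (simp add: y_def)
  ultimately have "(\<Sum>i=1..n. (x i - m i)\<^sup>2) \<le> (\<Sum>i=1..n. (x i - y i)\<^sup>2)"
    using lse unfolding is_constrained_lse_iff by blast
  also have "\<dots> = (\<Sum>i=1..n. (x i - m i)\<^sup>2 - 2 * d * ((x i - m i) * (w i - m i)) + d\<^sup>2 * (w i - m i)\<^sup>2)"
    by (intro sum.cong) (auto simp: y_def power2_eq_square algebra_simps)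
  also have "\<dots> = (\<Sum>i=1..n. (x i - m i)\<^sup>2) - 2 * d * A + d\<^sup>2 * B"
    by (simp add: A_def B_def sum.distrib sum_subtractf sum_distrib_left)
  finally have "d * (2 * A) \<le> d * (d * B)" by (simp add: power2_eq_square algebra_simps)
  then have "2 * A \<le> d * B" using d(1) by simp
  also have "\<dots> \<le> A / (B + 1) * B" using d(3) B by (rule mult_right_mono)
  also have "\<dots> \<le> A" using A B by (simp add: field_simps)
  finally show False using A by simp
qed

lemma block_decreasing_add:
  assumes "block_decreasing p I v" "block_decreasing p I w"
  shows "block_decreasing p I (\<lambda>i. v i + w i)"
  using assms unfolding block_decreasing_def by (meson add_mono)

text \<open>Feasible vectors are closed under addition, so the projection plus \<open>v\<close> is
  an admissible test vector in the variational inequality.\<close>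

lemma constrained_lse_polar:
  assumes I: "coarse_ranking n p ns I" and v: "block_decreasing p I v"
  shows "(\<Sum>i=1..n. (x i - constrained_lse n p I x i) * v i) \<le> 0"
  using constrained_lse_variational[OF I
      block_decreasing_add[OF block_decreasing_constrained_lse[OF I] v], of x x]
  by simp

text \<open>Each projection is tested against the other one; the two inequalities are added and a
  square is completed. The bound yields continuity, hence measurability, of the projection.\<close>

lemma constrained_lse_nonexpansive:
  assumes I: "coarse_ranking n p ns I"
  shows "(\<Sum>i=1..n. (constrained_lse n p I x i - constrained_lse n p I y i)\<^sup>2)
           \<le> (\<Sum>i=1..n. (x i - y i)\<^sup>2)"
proof -
  define m k where "m = constrained_lse n p I x" and "k = constrained_lse n p I y"
  have "(\<Sum>i=1..n. (x i - m i) * (k i - m i)) \<le> 0" "(\<Sum>i=1..n. (y i - k i) * (m i - k i)) \<le> 0"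
    unfolding m_def k_def
    by (intro constrained_lse_variational[OF I] block_decreasing_constrained_lse[OF I])+
  then have "0 \<le> - 2 * (\<Sum>i=1..n. (x i - m i) * (k i - m i)) - 2 * (\<Sum>i=1..n. (y i - k i) * (m i - k i))"
    by simp
  also have "\<dots> \<le> - 2 * (\<Sum>i=1..n. (x i - m i) * (k i - m i)) - 2 * (\<Sum>i=1..n. (y i - k i) * (m i - k i))
      + (\<Sum>i=1..n. ((x i - m i) - (y i - k i))\<^sup>2)"
    by (simp add: sum_nonneg)
  also have "\<dots> = (\<Sum>i=1..n. - 2 * ((x i - m i) * (k i - m i)) - 2 * ((y i - k i) * (m i - k i))
       + ((x i - m i) - (y i - k i))\<^sup>2)"
    by (simp only: sum.distrib sum_subtractf sum_distrib_left)
  also have "\<dots> = (\<Sum>i=1..n. (x i - y i)\<^sup>2 - (m i - k i)\<^sup>2)"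
    by (intro sum.cong) (auto simp: power2_eq_square algebra_simps)
  finally show ?thesis by (simp add: sum_subtractf m_def k_def)
qed

section \<open>Pathwise comparison of utilities\<close>

lemma convex_on_UNIV_subgradient:
  fixes U :: "real \<Rightarrow> real"
  assumes "convex_on UNIV U"
  obtains g where "mono g" "\<And>x y. U y \<ge> U x + g x * (y - x)"
proof -
  \<comment> \<open>The infimum of the difference quotients to the right of \<open>x\<close> is the
    right derivative of \<open>U\<close> at \<open>x\<close>.\<close>
  define g where "g x = Inf ((\<lambda>t. (U x - U t) / (x - t)) ` ({x<..} \<inter> UNIV))" for x
  have g: "U y \<ge> U x + g x * (y - x)" for x y
    unfolding g_def by (rule convex_le_Inf_differential[OF assms]) auto
  have "g x \<le> g y" if "x < y" for x y
  proof -
    have "0 \<le> (g y - g x) * (y - x)"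
      using g[of x y] g[of y x] by (simp add: algebra_simps)
    then show ?thesis using that by (simp add: zero_le_mult_iff)
  qed
  then have "mono g" by (intro monoI) (metis order_le_less)
  with g show thesis using that by blast
qed

lemma constrained_lse_orthogonal:
  fixes x :: "nat \<Rightarrow> real"
  assumes I: "coarse_ranking n p ns I" and g: "mono g"
  defines "m \<equiv> constrained_lse n p I x"
  shows "(\<Sum>i=1..n. (x i - m i) * g (m i)) = 0"
proof (rule antisym)
  have m: "block_decreasing p I m"
    unfolding m_def by (rule block_decreasing_constrained_lse[OF I])
  then have "block_decreasing p I (\<lambda>i. g (m i))"
    using g unfolding block_decreasing_def by (meson monoD)
  then show "(\<Sum>i=1..n. (x i - m i) * g (m i)) \<le> 0"
    unfolding m_def by (rule constrained_lse_polar[OF I])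
  \<comment> \<open>Ties stay ties, since equal values of \<open>m\<close> have equal values of
    \<open>g\<close>, and a strict gap absorbs a small perturbation. Only finitely many pairs occur,
    so one \<epsilon> serves them all.\<close>
  have "\<forall>\<^sub>F \<epsilon> in at_right 0. m t \<le> m s \<longrightarrow> m t - \<epsilon> * g (m t) \<le> m s - \<epsilon> * g (m s)" for s t
  proof (cases "m t < m s")
    case True
    have "((\<lambda>\<epsilon>. (m s - \<epsilon> * g (m s)) - (m t - \<epsilon> * g (m t)))
       \<longlongrightarrow> (m s - 0 * g (m s)) - (m t - 0 * g (m t))) (at_right 0)"
      by (intro tendsto_intros)
    then have "\<forall>\<^sub>F \<epsilon> in at_right 0. 0 < (m s - \<epsilon> * g (m s)) - (m t - \<epsilon> * g (m t))"
      by (rule order_tendstoD) (use True in simp)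
    then show ?thesis by eventually_elim auto
  next
    case False
    then show ?thesis by (intro always_eventually allI impI) (metis linorder_neqE order.refl not_less)
  qed
  then have "\<forall>\<^sub>F \<epsilon> in at_right 0. \<forall>s\<in>{1..n}. \<forall>t\<in>{1..n}.
      m t \<le> m s \<longrightarrow> m t - \<epsilon> * g (m t) \<le> m s - \<epsilon> * g (m s)"
    by (intro eventually_ball_finite ballI) auto
  then have "\<forall>\<^sub>F \<epsilon> in at_right (0::real). \<epsilon> > 0 \<and> (\<forall>s\<in>{1..n}. \<forall>t\<in>{1..n}.
      m t \<le> m s \<longrightarrow> m t - \<epsilon> * g (m t) \<le> m s - \<epsilon> * g (m s))"
    using eventually_at_right_less by (rule eventually_conj[rotated])
  then obtain \<epsilon> :: real where \<epsilon>: "\<epsilon> > 0"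
    "\<And>s t. s \<in> {1..n} \<Longrightarrow> t \<in> {1..n} \<Longrightarrow> m t \<le> m s \<Longrightarrow> m t - \<epsilon> * g (m t) \<le> m s - \<epsilon> * g (m s)"
    using eventually_happens'[OF trivial_limit_at_right_real] by blast
  have "block_decreasing p I (\<lambda>i. m i - \<epsilon> * g (m i))"
    unfolding block_decreasing_def
  proof (intro ballI impI \<epsilon>(2))
    fix i j s t assume ij: "i \<in> {1..p}" "j \<in> {1..p}" "i < j" "s \<in> I i" "t \<in> I j"
    then show "s \<in> {1..n}" "t \<in> {1..n}" using coarse_ranking_subset[OF I] by blast+
    show "m t \<le> m s" using m ij unfolding block_decreasing_def by blast
  qed
  from constrained_lse_variational[OF I this, of x]
  have "(\<Sum>i=1..n. (x i - m i) * (- \<epsilon> * g (m i))) \<le> 0" by (simp add: m_def)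
  also have "(\<Sum>i=1..n. (x i - m i) * (- \<epsilon> * g (m i))) = - \<epsilon> * (\<Sum>i=1..n. (x i - m i) * g (m i))"
    by (simp add: sum_distrib_left algebra_simps)
  finally show "0 \<le> (\<Sum>i=1..n. (x i - m i) * g (m i))"
    using \<epsilon>(1) by (simp add: zero_le_mult_iff)
qed

text \<open>The utility as a function of the data vector alone, ready to be integrated against the
  joint law.\<close>

definition lse_utility ::
  "nat \<Rightarrow> nat \<Rightarrow> (real \<Rightarrow> real) \<Rightarrow> (nat \<Rightarrow> nat set) \<Rightarrow> (nat \<Rightarrow> real) \<Rightarrow> real" where
  "lse_utility n p U I x = (\<Sum>i=1..n. U (constrained_lse n p I x i))"

lemma lse_utility_mono_polar:
  assumes I: "coarse_ranking n p ns I" and U: "convex_on UNIV U"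
    and xy: "\<And>v. block_decreasing p I v \<Longrightarrow> (\<Sum>i=1..n. (y i - x i) * v i) \<le> 0"
  shows "lse_utility n p U I y \<le> lse_utility n p U I x"
proof -
  obtain g where g: "mono g" "\<And>x y. U y \<ge> U x + g x * (y - x)"
    using convex_on_UNIV_subgradient[OF U] by blast
  define m k where "m = constrained_lse n p I x" and "k = constrained_lse n p I y"
  have "block_decreasing p I k"
    unfolding k_def by (rule block_decreasing_constrained_lse[OF I])
  then have gk: "block_decreasing p I (\<lambda>i. g (k i))"
    using g(1) unfolding block_decreasing_def by (meson monoD)
  \<comment> \<open>The splitting \<open>m - k = (y - k) - (y - x) - (x - m)\<close> is tested
    against \<open>g \<circ> k\<close>: the first sum vanishes by orthogonality, the two subtracted
    sums are nonpositive by polarity. The subgradient at \<open>k\<close> then bounds the utility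
    gain from below.\<close>
  have "0 \<le> (\<Sum>i=1..n. (y i - k i) * g (k i)) - (\<Sum>i=1..n. (y i - x i) * g (k i))
             - (\<Sum>i=1..n. (x i - m i) * g (k i))"
    using constrained_lse_orthogonal[OF I g(1), of y] xy[OF gk] constrained_lse_polar[OF I gk, of x]
    by (simp add: m_def k_def)
  also have "\<dots> = (\<Sum>i=1..n. g (k i) * (m i - k i))"
    unfolding sum_subtractf[symmetric] by (intro sum.cong) (auto simp: algebra_simps)
  also have "\<dots> \<le> (\<Sum>i=1..n. U (m i) - U (k i))"
    using g(2) by (intro sum_mono) (simp add: le_diff_eq add.commute)
  finally show ?thesis
    by (simp add: lse_utility_def m_def k_def sum_subtractf)
qed

lemma lse_utility_transpose_le:
  assumes I: "coarse_ranking n p ns I" and U: "convex_on UNIV U"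
    and ij: "i \<in> {1..p}" "j \<in> {1..p}" "i < j" "s \<in> I i" "t \<in> I j" and le: "x t \<le> x s"
  shows "lse_utility n p U I (x \<circ> Transposition.transpose s t) \<le> lse_utility n p U I x"
proof (rule lse_utility_mono_polar[OF I U])
  fix v assume "block_decreasing p I v"
  then have v: "v t \<le> v s" using ij unfolding block_decreasing_def by blast
  have st: "s \<in> {1..n}" "t \<in> {1..n}"
    using coarse_ranking_subset[OF I] ij by blast+
  have "I i \<inter> I j = {}"
    using I ij(1-3) by (simp add: coarse_ranking_def disjoint_family_on_def)
  then have "s \<noteq> t" using ij by blast
  then have "(\<Sum>i=1..n. ((x \<circ> Transposition.transpose s t) i - x i) * v i)
      = (\<Sum>i\<in>{s,t}. ((x \<circ> Transposition.transpose s t) i - x i) * v i)"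
    using st by (intro sum.mono_neutral_right) auto
  also have "\<dots> = - (x s - x t) * (v s - v t)"
    using \<open>s \<noteq> t\<close> by (simp add: algebra_simps)
  also have "\<dots> \<le> 0" using v le by (simp add: mult_nonpos_nonneg)
  finally show "(\<Sum>i=1..n. ((x \<circ> Transposition.transpose s t) i - x i) * v i) \<le> 0" .
qed

section \<open>Relabelling of indices and measurability\<close>

lemma constrained_lse_cong:
  assumes "\<And>i. i \<in> {1..n} \<Longrightarrow> x i = y i" "\<And>j. j \<in> {1..p} \<Longrightarrow> I j = J j"
  shows "constrained_lse n p I x = constrained_lse n p J y"
proof -
  have "block_decreasing p I = block_decreasing p J"
    using assms(2) unfolding block_decreasing_def by (intro ext ball_cong refl imp_cong) auto
  moreover have "(\<Sum>i=1..n. (x i - m i)\<^sup>2) = (\<Sum>i=1..n. (y i - m i)\<^sup>2)" for m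
    using assms(1) by (intro sum.cong) auto
  ultimately show ?thesis
    unfolding constrained_lse_def is_constrained_lse_def by simp
qed

lemma coarse_ranking_permute:
  assumes I: "coarse_ranking n p ns I" and \<tau>: "\<tau> permutes {1..n}"
  shows "coarse_ranking n p ns (\<lambda>j. \<tau> ` I j)"
proof -
  have inj: "inj \<tau>" using \<tau> by (rule permutes_inj)
  have "(\<Union>j\<in>{1..p}. \<tau> ` I j) = \<tau> ` {1..n}"
    using I unfolding coarse_ranking_def by blast
  then have "(\<Union>j\<in>{1..p}. \<tau> ` I j) = {1..n}" using permutes_image[OF \<tau>] by simp
  then show ?thesis
    using I card_image[OF inj_on_subset[OF inj]]
    unfolding coarse_ranking_def disjoint_family_on_def image_Int[OF inj, symmetric] by simp
qed

text \<open>This trades an exchange of two data values for an exchange of two indices between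
  blocks. The minimizer for the relabelled blocks is the old one composed with
  \<open>inv \<tau>\<close>.\<close>

lemma lse_utility_permute:
  assumes I: "coarse_ranking n p ns I" and \<tau>: "\<tau> permutes {1..n}"
  shows "lse_utility n p U (\<lambda>j. \<tau> ` I j) x = lse_utility n p U I (x \<circ> \<tau>)"
proof -
  define m where "m = constrained_lse n p I (x \<circ> \<tau>)"
  have bd: "block_decreasing p (\<lambda>j. \<tau> ` I j) y \<longleftrightarrow> block_decreasing p I (y \<circ> \<tau>)" for y
    by (auto simp: block_decreasing_def)
  have inv: "inv \<tau> permutes {1..n}" using \<tau> by (rule permutes_inv)
  \<comment> \<open>Permutations fix the points outside \<open>{1..n}\<close>, so the default value
    \<open>undefined\<close> stays in place there.\<close>
  have ext: "y \<circ> \<sigma> \<in> extensional {1..n}" if "y \<in> extensional {1..n}" "\<sigma> permutes {1..n}"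
    for y :: "nat \<Rightarrow> real" and \<sigma>
    using that permutes_not_in[OF that(2)] by (auto simp: extensional_def)
  have m: "is_constrained_lse n p I (x \<circ> \<tau>) m"
    unfolding m_def by (rule is_constrained_lse_constrained_lse[OF I])
  have cancel: "m \<circ> inv \<tau> \<circ> \<tau> = m"
    using permutes_inv_o(2)[OF \<tau>] by (simp add: comp_assoc)
  have perm: "(\<Sum>i=1..n. f (\<tau> i)) = (\<Sum>i=1..n. f i)" for f :: "nat \<Rightarrow> real"
    using sum.permute[OF \<tau>, of f] by simp
  have "is_constrained_lse n p (\<lambda>j. \<tau> ` I j) x (m \<circ> inv \<tau>)"
    unfolding is_constrained_lse_iff bd cancel
  proof (intro conjI allI impI)
    show "m \<circ> inv \<tau> \<in> extensional {1..n}" "block_decreasing p I m"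
      using m ext inv by (auto simp: is_constrained_lse_iff)
    fix y assume y: "y \<in> extensional {1..n}" "block_decreasing p I (y \<circ> \<tau>)"
    have "(\<Sum>i=1..n. (x i - (m \<circ> inv \<tau>) i)\<^sup>2) = (\<Sum>i=1..n. ((x \<circ> \<tau>) i - m i)\<^sup>2)"
      using perm[of "\<lambda>i. (x i - (m \<circ> inv \<tau>) i)\<^sup>2"] permutes_inverses(2)[OF \<tau>] by simp
    also have "\<dots> \<le> (\<Sum>i=1..n. ((x \<circ> \<tau>) i - (y \<circ> \<tau>) i)\<^sup>2)"
      using m ext[OF y(1) \<tau>] y(2) unfolding is_constrained_lse_iff by blast
    also have "\<dots> = (\<Sum>i=1..n. (x i - y i)\<^sup>2)"
      using perm[of "\<lambda>i. (x i - y i)\<^sup>2"] by simp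
    finally show "(\<Sum>i=1..n. (x i - (m \<circ> inv \<tau>) i)\<^sup>2) \<le> (\<Sum>i=1..n. (x i - y i)\<^sup>2)" .
  qed
  then have "constrained_lse n p (\<lambda>j. \<tau> ` I j) x = m \<circ> inv \<tau>"
    by (rule constrained_lse_eqI[OF coarse_ranking_permute[OF I \<tau>]])
  then have "lse_utility n p U (\<lambda>j. \<tau> ` I j) x = (\<Sum>i=1..n. U (m (inv \<tau> i)))"
    by (simp add: lse_utility_def)
  also have "\<dots> = (\<Sum>i=1..n. U (m i))"
    using perm[of "\<lambda>i. U (m (inv \<tau> i))"] permutes_inverses(2)[OF \<tau>] by simp
  finally show ?thesis by (simp add: lse_utility_def m_def)
qed

text \<open>Convergence in the product topology makes the Euclidean distance over the finitely many
  relevant coordinates vanish, and nonexpansiveness passes this on to the projection.\<close>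

lemma continuous_on_constrained_lse:
  assumes I: "coarse_ranking n p ns I" and i: "i \<in> {1..n}"
  shows "continuous_on UNIV (\<lambda>x. constrained_lse n p I x i)"
  unfolding continuous_on_eq_continuous_at[OF open_UNIV]
proof
  fix x :: "nat \<Rightarrow> real"
  let ?m = "\<lambda>y. constrained_lse n p I y i"
  have "isCont (\<lambda>y::nat \<Rightarrow> real. y k) x" for k
    by (rule continuous_on_interior[OF continuous_on_product_coordinates]) simp
  then have "((\<lambda>y::nat \<Rightarrow> real. y k) \<longlongrightarrow> x k) (at x)" for k
    by (simp add: isCont_def)
  then have "((\<lambda>y. sqrt (\<Sum>k=1..n. (y k - x k)\<^sup>2)) \<longlongrightarrow> sqrt (\<Sum>k=1..n. (x k - x k)\<^sup>2)) (at x)"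
    by (intro tendsto_intros)
  then have lim: "((\<lambda>y. sqrt (\<Sum>k=1..n. (y k - x k)\<^sup>2)) \<longlongrightarrow> 0) (at x)" by simp
  have "\<bar>?m y - ?m x\<bar> \<le> sqrt (\<Sum>k=1..n. (y k - x k)\<^sup>2)" for y
  proof -
    have "(?m y - ?m x)\<^sup>2 \<le> (\<Sum>k=1..n. (constrained_lse n p I y k - constrained_lse n p I x k)\<^sup>2)"
      using i by (intro member_le_sum) auto
    also have "\<dots> \<le> (\<Sum>k=1..n. (y k - x k)\<^sup>2)"
      by (rule constrained_lse_nonexpansive[OF I])
    finally show ?thesis
      by (metis real_sqrt_abs real_sqrt_le_iff)
  qed
  then have "((\<lambda>y. ?m y - ?m x) \<longlongrightarrow> 0) (at x)"
    by (intro Lim_null_comparison[OF always_eventually lim]) simp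
  then show "isCont ?m x" by (simp add: isCont_def LIM_zero_iff)
qed

lemma borel_measurable_lse_utility:
  assumes I: "coarse_ranking n p ns I" and U: "convex_on UNIV U"
  shows "lse_utility n p U I \<in> borel_measurable (Pi\<^sub>M {1..n} (\<lambda>_. borel))"
proof -
  have "continuous_on UNIV (lse_utility n p U I)"
    unfolding lse_utility_def
    by (intro continuous_on_sum continuous_on_compose2[OF convex_on_continuous[OF open_UNIV U]]
        continuous_on_constrained_lse[OF I]) auto
  then have "lse_utility n p U I \<in> borel_measurable borel"
    by (rule borel_measurable_continuous_onI)
  \<comment> \<open>Borel sets of \<open>nat \<Rightarrow> real\<close> involve all coordinates, but
    on the product space those outside \<open>{1..n}\<close> are constantly
    \<open>undefined\<close>.\<close>
  moreover have "(\<lambda>x. x) \<in> borel_measurable (Pi\<^sub>M {1..n} (\<lambda>_. borel :: real measure))"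
  proof (rule measurable_coordinatewise_then_product)
    fix i :: nat
    show "(\<lambda>x. x i) \<in> borel_measurable (Pi\<^sub>M {1..n} (\<lambda>_. borel :: real measure))"
    proof (cases "i \<in> {1..n}")
      case False
      have "(\<lambda>x. undefined) \<in> borel_measurable (Pi\<^sub>M {1..n} (\<lambda>_. borel :: real measure))" by simp
      then show ?thesis
        by (rule measurable_cong[THEN iffD1, rotated])
           (use False in \<open>auto simp: space_PiM PiE_def extensional_def\<close>)
    qed (rule measurable_component_singleton)
  qed
  ultimately show ?thesis by (rule measurable_compose[rotated])
qed

section \<open>Exchanging two coordinates of a product measure\<close>

text \<open>Writing \<open>a = b + e\<close> replaces the usual product of differences, which breaks
  down for infinite values.\<close>

lemma ennreal_rearrangement:
  fixes a b c d :: ennreal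
  assumes "b \<le> a" "d \<le> c"
  shows "a * d + b * c \<le> a * c + b * d"
proof -
  obtain e where e: "a = b + e" using assms(1) le_iff_add by blast
  have "a * d + b * c = b * d + b * c + e * d"
    by (simp add: e ring_distribs add_ac)
  also have "\<dots> \<le> b * d + b * c + e * c"
    by (intro add_left_mono mult_left_mono assms(2)) simp
  also have "\<dots> = a * c + b * d"
    by (simp add: e ring_distribs add_ac)
  finally show ?thesis .
qed

text \<open>It suffices to compare boxes; there the weight joins the factor at \<open>t\<close> and
  the integral splits into a product.\<close>

lemma PiM_density_component:
  fixes P :: "'i \<Rightarrow> 'b measure"
  assumes J: "finite J" and P: "\<And>i. prob_space (P i)" and t: "t \<in> J"
    and L: "L \<in> borel_measurable (P t)" and PL: "prob_space (density (P t) L)"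
  shows "Pi\<^sub>M J (P(t := density (P t) L)) = density (Pi\<^sub>M J P) (\<lambda>x. L (x t))"
proof -
  let ?P' = "P(t := density (P t) L)"
  have P': "prob_space (?P' i)" for i using P PL by simp
  interpret P: product_sigma_finite P
    by (intro product_sigma_finite.intro prob_space_imp_sigma_finite P)
  interpret P': product_sigma_finite ?P'
    by (intro product_sigma_finite.intro prob_space_imp_sigma_finite P')
  have sets': "sets (?P' i) = sets (P i)" for i by simp
  have Lt: "(\<lambda>x. L (x t)) \<in> borel_measurable (Pi\<^sub>M J P)"
    by (rule measurable_compose[OF measurable_component_singleton[OF t, of P] L])
  show ?thesis
  proof (rule P'.PiM_eqI[OF J, symmetric])
    show "sets (density (Pi\<^sub>M J P) (\<lambda>x. L (x t))) = sets (Pi\<^sub>M J ?P')"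
      unfolding sets_density by (intro sets_PiM_cong refl sets'[symmetric])
    fix A assume "\<And>i. i \<in> J \<Longrightarrow> A i \<in> sets (?P' i)"
    then have A: "A i \<in> sets (P i)" if "i \<in> J" for i using that unfolding sets' by blast
    let ?f = "\<lambda>i y. (if i = t then L y else 1) * indicator (A i) y"
    have f: "?f i \<in> borel_measurable (P i)" if "i \<in> J" for i
      using L A[OF that] by (cases "i = t") auto
    have "emeasure (density (Pi\<^sub>M J P) (\<lambda>x. L (x t))) (Pi\<^sub>E J A)
        = (\<integral>\<^sup>+x. L (x t) * indicator (Pi\<^sub>E J A) x \<partial>Pi\<^sub>M J P)"
      using A J by (intro emeasure_density Lt sets_PiM_I_finite)
    also have "\<dots> = (\<integral>\<^sup>+x. (\<Prod>i\<in>J. ?f i (x i)) \<partial>Pi\<^sub>M J P)"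
    proof (intro nn_integral_cong)
      fix x assume "x \<in> space (Pi\<^sub>M J P)"
      then have "indicator (Pi\<^sub>E J A) x = (\<Prod>i\<in>J. indicator (A i) (x i) :: ennreal)"
        using J by (auto simp: space_PiM PiE_iff indicator_def prod_zero_iff)
      then show "L (x t) * indicator (Pi\<^sub>E J A) x = (\<Prod>i\<in>J. ?f i (x i))"
        using J t by (simp add: prod.distrib prod.delta)
    qed
    also have "\<dots> = (\<Prod>i\<in>J. \<integral>\<^sup>+y. ?f i y \<partial>P i)"
      by (rule P.product_nn_integral_prod[OF J f])
    also have "\<dots> = (\<Prod>i\<in>J. emeasure (?P' i) (A i))"
      using A by (intro prod.cong refl) (auto simp: emeasure_density L)
    finally show "emeasure (density (Pi\<^sub>M J P) (\<lambda>x. L (x t))) (Pi\<^sub>E J A)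
        = (\<Prod>i\<in>J. emeasure (?P' i) (A i))" .
  qed
qed

lemma PiM_transpose_nn_integral_le:
  fixes P :: "'i \<Rightarrow> real measure"
  assumes J: "finite J" and P: "\<And>i. prob_space (P i)" and sets: "\<And>i. sets (P i) = sets borel"
    and st: "s \<in> J" "t \<in> J" "s \<noteq> t"
    and L: "L \<in> borel_measurable borel" "mono L" "P t = density (P s) L"
    and h: "h \<in> borel_measurable (Pi\<^sub>M J (\<lambda>_. borel))"
    and h_le: "\<And>x. x t \<le> x s \<Longrightarrow> h (x \<circ> Transposition.transpose s t) \<le> h x"
  shows "(\<integral>\<^sup>+x. h x \<partial>Pi\<^sub>M J P) \<le> (\<integral>\<^sup>+x. h (x \<circ> Transposition.transpose s t) \<partial>Pi\<^sub>M J P)"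
proof -
  let ?\<tau> = "Transposition.transpose s t"
  \<comment> \<open>Both exchanged coordinates get the law \<open>P s\<close>, which makes the
    product \<open>Q\<close> invariant under \<open>?\<tau>\<close>.\<close>
  define R where "R = P(t := P s)"
  define Q where "Q = Pi\<^sub>M J R"
  have R: "prob_space (R i)" "sets (R i) = sets borel" for i
    using P sets by (auto simp: R_def)
  have setsQ: "sets Q = sets (Pi\<^sub>M J (\<lambda>_. borel))"
    unfolding Q_def by (intro sets_PiM_cong refl R)
  note meas = measurable_cong_sets[OF setsQ refl]
  have hQ [measurable]: "h \<in> borel_measurable Q" using h unfolding meas .
  have [measurable]: "L \<in> borel_measurable borel" by (rule L)
  have comp [measurable]: "(\<lambda>x. x i) \<in> borel_measurable Q" if "i \<in> J" for i
    using measurable_component_singleton[OF that, of "\<lambda>_. borel"] unfolding meas .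
  have \<tau>J: "?\<tau> i \<in> J \<longleftrightarrow> i \<in> J" for i
    using st by (cases "i = s \<or> i = t") auto
  have \<tau>m [measurable]: "(\<lambda>x. x \<circ> ?\<tau>) \<in> measurable Q Q"
  proof -
    have "(\<lambda>x. \<lambda>i\<in>J. x (?\<tau> i)) \<in> measurable Q (Pi\<^sub>M J (\<lambda>_. borel))"
      by (intro measurable_restrict comp) (simp add: \<tau>J)
    then have "(\<lambda>x. \<lambda>i\<in>J. x (?\<tau> i)) \<in> measurable Q Q"
      using measurable_cong_sets[OF refl setsQ] by blast
    \<comment> \<open>Points of the product space are \<open>undefined\<close> off \<open>J\<close>
      and \<open>?\<tau>\<close> preserves \<open>J\<close>, so the restriction changes
      nothing.\<close>
    moreover have "(\<lambda>i\<in>J. x (?\<tau> i)) = x \<circ> ?\<tau>" if "x \<in> space Q" for x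
      using that by (auto simp: Q_def space_PiM PiE_def extensional_def fun_eq_iff restrict_def \<tau>J)
    ultimately show ?thesis by (subst measurable_cong[symmetric])
  qed
  have inv: "(\<integral>\<^sup>+x. f (x \<circ> ?\<tau>) \<partial>Q) = (\<integral>\<^sup>+x. f x \<partial>Q)" if [measurable]: "f \<in> borel_measurable Q" for f
  proof -
    have R\<tau>: "(\<lambda>i. R (?\<tau> i)) = R"
      by (auto simp: R_def fun_eq_iff Transposition.transpose_def)
    have "distr Q Q (\<lambda>x. \<lambda>i\<in>J. x (?\<tau> i)) = Q"
      unfolding Q_def using distr_PiM_reindex[of J R ?\<tau> J] R(1) \<tau>J by (simp add: R\<tau>)
    moreover have "distr Q Q (\<lambda>x. \<lambda>i\<in>J. x (?\<tau> i)) = distr Q Q (\<lambda>x. x \<circ> ?\<tau>)"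
      by (intro distr_cong)
        (auto simp: Q_def space_PiM PiE_def extensional_def fun_eq_iff restrict_def \<tau>J)
    ultimately have "distr Q Q (\<lambda>x. x \<circ> ?\<tau>) = Q" by simp
    then have "(\<integral>\<^sup>+x. f x \<partial>Q) = (\<integral>\<^sup>+x. f x \<partial>distr Q Q (\<lambda>x. x \<circ> ?\<tau>))" by simp
    also have "\<dots> = (\<integral>\<^sup>+x. f (x \<circ> ?\<tau>) \<partial>Q)"
      by (intro nn_integral_distr) measurable
    finally show ?thesis by simp
  qed
  have dens: "Pi\<^sub>M J P = density Q (\<lambda>x. L (x t))"
  proof -
    have "P = R(t := density (R t) L)" using L(3) st by (auto simp: R_def)
    then show ?thesis
      unfolding Q_def using PiM_density_component[of J R t L] J R(1) st P[of t] L(3)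
      by (auto simp: R_def measurable_cong_sets[OF sets refl] L(1))
  qed
  \<comment> \<open>\<open>A\<close> is the left-hand side of the claim; by invariance of
    \<open>Q\<close>, \<open>B\<close> is the right-hand side.\<close>
  define A where "A = (\<integral>\<^sup>+x. h x * L (x t) \<partial>Q)"
  define B where "B = (\<integral>\<^sup>+x. h x * L (x s) \<partial>Q)"
  have [measurable]: "(\<lambda>x. h (x \<circ> ?\<tau>)) \<in> borel_measurable Q"
    by (rule measurable_compose[OF \<tau>m hQ])
  have Lm [measurable]: "(\<lambda>x. L (x t)) \<in> borel_measurable Q" "(\<lambda>x. L (x s)) \<in> borel_measurable Q"
    using measurable_compose[OF comp L(1)] st by auto
  have A': "A = (\<integral>\<^sup>+x. h (x \<circ> ?\<tau>) * L (x s) \<partial>Q)"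
    unfolding A_def using inv[of "\<lambda>x. h x * L (x t)"] by simp
  have B': "B = (\<integral>\<^sup>+x. h (x \<circ> ?\<tau>) * L (x t) \<partial>Q)"
    unfolding B_def using inv[of "\<lambda>x. h x * L (x s)"] by simp
  \<comment> \<open>Each integral is counted twice, once as defined and once after the exchange, so
    that rearrangement compares the integrands point by point.\<close>
  have "A + A = (\<integral>\<^sup>+x. h x * L (x t) + h (x \<circ> ?\<tau>) * L (x s) \<partial>Q)"
    by (subst nn_integral_add) (auto simp: A_def[symmetric] A'[symmetric])
  also have "\<dots> \<le> (\<integral>\<^sup>+x. h x * L (x s) + h (x \<circ> ?\<tau>) * L (x t) \<partial>Q)"
  proof (intro nn_integral_mono)
    fix x
    show "h x * L (x t) + h (x \<circ> ?\<tau>) * L (x s) \<le> h x * L (x s) + h (x \<circ> ?\<tau>) * L (x t)"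
    proof (cases "x t \<le> x s")
      case True
      then show ?thesis
        by (intro ennreal_rearrangement h_le monoD[OF L(2)])
    next
      case False
      \<comment> \<open>The hypothesis on \<open>h\<close> is applied to the exchanged vector, which
        has its larger value at \<open>s\<close>.\<close>
      then have "h x \<le> h (x \<circ> ?\<tau>)" "L (x s) \<le> L (x t)"
        using h_le[of "x \<circ> ?\<tau>"] monoD[OF L(2)] by (auto simp: comp_assoc)
      from ennreal_rearrangement[OF this] show ?thesis by (simp add: add.commute)
    qed
  qed
  also have "\<dots> = B + B"
    by (subst nn_integral_add) (auto simp: B_def[symmetric] B'[symmetric])
  finally have "A \<le> B"
    by (simp add: mult_2[symmetric] ennreal_mult_le_mult_iff)
  moreover have "(\<integral>\<^sup>+x. h x \<partial>Pi\<^sub>M J P) = A" "(\<integral>\<^sup>+x. h (x \<circ> ?\<tau>) \<partial>Pi\<^sub>M J P) = B"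
    unfolding dens A_def B' by (subst nn_integral_density; simp add: mult.commute)+
  ultimately show ?thesis by simp
qed

text \<open>The nonnegative case is applied to the positive part of \<open>f\<close> and to the
  negative part of the exchanged \<open>f\<close>, because negation reverses the pathwise
  inequality. Both parts then move in the favourable direction.\<close>

lemma PiM_transpose_ext_expectation_le:
  fixes P :: "'i \<Rightarrow> real measure"
  assumes J: "finite J" and P: "\<And>i. prob_space (P i)" and sets: "\<And>i. sets (P i) = sets borel"
    and st: "s \<in> J" "t \<in> J" "s \<noteq> t"
    and L: "L \<in> borel_measurable borel" "mono L" "P t = density (P s) L"
    and f: "f \<in> borel_measurable (Pi\<^sub>M J (\<lambda>_. borel))"
    and f_le: "\<And>x. x t \<le> x s \<Longrightarrow> f (x \<circ> Transposition.transpose s t) \<le> f x"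
  shows "ext_expectation (Pi\<^sub>M J P) f
       \<le> ext_expectation (Pi\<^sub>M J P) (\<lambda>x. f (x \<circ> Transposition.transpose s t))"
proof -
  let ?\<tau> = "Transposition.transpose s t"
  have \<tau>J: "?\<tau> i \<in> J \<longleftrightarrow> i \<in> J" for i
    using st by (cases "i = s \<or> i = t") auto
  have \<tau>m: "(\<lambda>x. x \<circ> ?\<tau>) \<in> measurable (Pi\<^sub>M J (\<lambda>_. borel)) (Pi\<^sub>M J (\<lambda>_. borel :: real measure))"
  proof (rule measurable_cong[THEN iffD1])
    show "(\<lambda>x. \<lambda>i\<in>J. x (?\<tau> i)) \<in> measurable (Pi\<^sub>M J (\<lambda>_. borel)) (Pi\<^sub>M J (\<lambda>_. borel :: real measure))"
      by (intro measurable_restrict measurable_component_singleton) (simp add: \<tau>J)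
  qed (auto simp: space_PiM PiE_def extensional_def fun_eq_iff restrict_def \<tau>J)
  have "(\<integral>\<^sup>+x. ennreal (f x) \<partial>Pi\<^sub>M J P) \<le> (\<integral>\<^sup>+x. ennreal (f (x \<circ> ?\<tau>)) \<partial>Pi\<^sub>M J P)"
    by (rule PiM_transpose_nn_integral_le[OF J P sets st L])
       (use f f_le in \<open>auto intro: ennreal_leI\<close>)
  moreover have "(\<integral>\<^sup>+x. ennreal (- f (x \<circ> ?\<tau>)) \<partial>Pi\<^sub>M J P)
      \<le> (\<integral>\<^sup>+x. ennreal (- f (x \<circ> ?\<tau> \<circ> ?\<tau>)) \<partial>Pi\<^sub>M J P)"
  proof (rule PiM_transpose_nn_integral_le[OF J P sets st L])
    show "(\<lambda>x. ennreal (- f (x \<circ> ?\<tau>))) \<in> borel_measurable (Pi\<^sub>M J (\<lambda>_. borel))"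
      using measurable_compose[OF \<tau>m f] by simp
    show "ennreal (- f (x \<circ> ?\<tau> \<circ> ?\<tau>)) \<le> ennreal (- f (x \<circ> ?\<tau>))" if "x t \<le> x s" for x
      using f_le[OF that] by (auto intro: ennreal_leI simp: comp_assoc)
  qed
  ultimately show ?thesis
    unfolding ext_expectation_def
    by (intro ereal_minus_mono) (simp_all add: comp_assoc less_eq_ennreal.rep_eq)
qed

section \<open>Monotone likelihood ratio and the joint law of the sample\<close>

context regular_exp_family
begin

text \<open>The second derivative is positive on the whole segment, which lies in the interval
  \<Theta>. This turns the order of the means into the order of the parameters.\<close>

lemma deriv_logpart_strict_mono:
  assumes "\<theta>\<^sub>1 \<in> \<Theta>" "\<theta>\<^sub>2 \<in> \<Theta>" "\<theta>\<^sub>1 < \<theta>\<^sub>2"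
  shows "deriv b \<theta>\<^sub>1 < deriv b \<theta>\<^sub>2"
proof (rule DERIV_pos_imp_increasing[OF assms(3)])
  fix x assume "\<theta>\<^sub>1 \<le> x" "x \<le> \<theta>\<^sub>2"
  then have "x \<in> \<Theta>" using mem_is_interval_1_I[OF params_interval assms(1,2)] by blast
  then show "\<exists>y. (deriv b has_real_derivative y) (at x) \<and> y > 0"
    using logpart_deriv_differentiable logpart_deriv2_pos
    by (meson DERIV_deriv_iff_real_differentiable)
qed

text \<open>The likelihood ratio: the carrier cancels and leaves an exponential in \<open>x\<close>,
  increasing when the second parameter is the larger one.\<close>

lemma exp_family_law_density:
  "exp_family_law \<rho> c b \<theta>\<^sub>2 =
     density (exp_family_law \<rho> c b \<theta>\<^sub>1) (\<lambda>x. ennreal (exp ((\<theta>\<^sub>2 - \<theta>\<^sub>1) * x - (b \<theta>\<^sub>2 - b \<theta>\<^sub>1))))"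
proof -
  have [measurable]: "c \<in> borel_measurable \<rho>" "(\<lambda>x. x) \<in> borel_measurable \<rho>"
    using carrier_measurable measurable_cong_sets[OF sets_base refl]
      measurable_ident_sets[OF sets_base] by blast+
  have *: "exp (\<theta>\<^sub>1 * x - b \<theta>\<^sub>1) * c x * exp ((\<theta>\<^sub>2 - \<theta>\<^sub>1) * x - (b \<theta>\<^sub>2 - b \<theta>\<^sub>1)) = exp (\<theta>\<^sub>2 * x - b \<theta>\<^sub>2) * c x" for x
    by (simp add: mult.assoc[symmetric] mult.commute[of _ "c x"] exp_add[symmetric] algebra_simps)
  show ?thesis
    unfolding exp_family_law_def
    by (subst density_density_eq)
      (auto simp: ennreal_mult'[symmetric] ennreal_mult[symmetric] carrier_nonneg *)
qed

lemma sets_exp_family_law: "sets (exp_family_law \<rho> c b \<theta>) = sets borel"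
  by (simp add: exp_family_law_def sets_base)

end

text \<open>The expectation depends on the sample only through its joint law, which independence
  identifies with the product of the marginals.\<close>

lemma Util_eq_PiM:
  fixes X :: "nat \<Rightarrow> 'a \<Rightarrow> real"
  assumes I: "coarse_ranking n p ns I" and U: "convex_on UNIV U"
    and M: "prob_space M" and "n > 0" and X: "prob_space.indep_vars M (\<lambda>_. borel) X {1..n}"
    and P: "\<And>i. i \<in> {1..n} \<Longrightarrow> distr M borel (X i) = P i"
  shows "Util M n p X U I = ext_expectation (Pi\<^sub>M {1..n} P) (lse_utility n p U I)"
proof -
  interpret prob_space M by (rule M)
  have rv [measurable]: "X i \<in> borel_measurable M" if "i \<in> {1..n}" for i
    using X that by (simp add: indep_vars_def)
  let ?Y = "\<lambda>\<omega>. \<lambda>i\<in>{1..n}. X i \<omega>"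
  have Y: "?Y \<in> measurable M (Pi\<^sub>M {1..n} (\<lambda>_. borel))"
    by (intro measurable_restrict rv)
  have "distr M (Pi\<^sub>M {1..n} (\<lambda>_. borel)) ?Y = Pi\<^sub>M {1..n} (\<lambda>i. distr M borel (X i))"
    using X indep_vars_iff_distr_eq_PiM'[where M' = "\<lambda>_. borel" and X = X and I = "{1..n}"] rv \<open>n > 0\<close> by simp
  also have "\<dots> = Pi\<^sub>M {1..n} P" by (intro PiM_cong refl P)
  finally have PiM: "Pi\<^sub>M {1..n} P = distr M (Pi\<^sub>M {1..n} (\<lambda>_. borel)) ?Y" ..
  have G: "lse_utility n p U I (?Y \<omega>) = (\<Sum>i=1..n. U (constrained_lse n p I (\<lambda>i. X i \<omega>) i))" for \<omega>
    unfolding lse_utility_def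
    using constrained_lse_cong[of n "?Y \<omega>" "\<lambda>i. X i \<omega>" p I I] by simp
  note m = borel_measurable_lse_utility[OF I U]
  show ?thesis
    unfolding Util_def ext_expectation_def PiM G[symmetric]
    by (subst (1 2) nn_integral_distr[OF Y]) (use m in simp_all)
qed

lemma block_decreasing_consecutive_blocks:
  assumes n: "(\<Sum>j=1..p. ns j) = n"
    and \<mu>: "\<And>i j. 1 \<le> i \<Longrightarrow> i \<le> j \<Longrightarrow> j \<le> n \<Longrightarrow> \<mu> (\<pi> i) \<ge> \<mu> (\<pi> j)"
  shows "block_decreasing p (consecutive_blocks ns \<pi>) \<mu>"
  unfolding block_decreasing_def
proof (intro ballI impI)
  fix i j s t assume ij: "i \<in> {1..p}" "j \<in> {1..p}" "i < j"
    and s: "s \<in> consecutive_blocks ns \<pi> i" and t: "t \<in> consecutive_blocks ns \<pi> j"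
  obtain k where k: "s = \<pi> k" "1 \<le> k" "k \<le> (\<Sum>k=1..i. ns k)"
    using s by (auto simp: consecutive_blocks_def)
  obtain l where l: "t = \<pi> l" "1 + (\<Sum>k=1..j-1. ns k) \<le> l" "l \<le> (\<Sum>k=1..j. ns k)"
    using t by (auto simp: consecutive_blocks_def)
  \<comment> \<open>Positions in block \<open>i\<close> end at the first partial sum, and those in
    block \<open>j\<close> start one past the sum up to \<open>j-1\<close>.\<close>
  have "(\<Sum>k=1..i. ns k) \<le> (\<Sum>k=1..j-1. ns k)" "(\<Sum>k=1..j. ns k) \<le> (\<Sum>k=1..p. ns k)"
    using ij by (auto intro!: sum_mono2)
  then show "\<mu> t \<le> \<mu> s" unfolding k(1) l(1) using k l n by (intro \<mu>) auto
qed

section \<open>Exchanging misplaced indices\<close>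

text \<open>At the first block where the rankings differ, equal cardinality gives an index in each
  set difference. Earlier blocks coincide, so each of the two indices lies in a later block of the
  other ranking.\<close>

lemma coarse_ranking_misplaced_pair:
  assumes I: "coarse_ranking n p ns I" and J: "coarse_ranking n p ns J"
    and ne: "\<exists>j\<in>{1..p}. I j \<noteq> J j"
  obtains i j s t where "i \<in> {1..p}" "j \<in> {1..p}" "i < j" "s \<in> I i" "t \<in> I j" "t \<in> J i"
    "\<exists>l\<in>{1..p}. i < l \<and> s \<in> J l"
proof -
  define i where "i = (LEAST j. j \<in> {1..p} \<and> I j \<noteq> J j)"
  have i: "i \<in> {1..p}" "I i \<noteq> J i"
    using LeastI_ex[of "\<lambda>j. j \<in> {1..p} \<and> I j \<noteq> J j"] ne unfolding i_def by blast+
  have below: "I j = J j" if "j \<in> {1..p}" "j < i" for j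
    using not_less_Least[of j "\<lambda>j. j \<in> {1..p} \<and> I j \<noteq> J j"] that unfolding i_def by blast
  have sub: "I i \<subseteq> {1..n}" "J i \<subseteq> {1..n}"
    using coarse_ranking_subset[OF I i(1)] coarse_ranking_subset[OF J i(1)] by blast+
  have card: "card (I i) = card (J i)" using I J i(1) by (simp add: coarse_ranking_def)
  have fin: "finite (I i)" "finite (J i)" using sub finite_subset by blast+
  obtain s where s: "s \<in> I i" "s \<notin> J i" using card_subset_eq[OF fin(2)] card i(2) by blast
  obtain t where t: "t \<in> J i" "t \<notin> I i" using card_subset_eq[OF fin(1), of "J i"] card i(2) by auto
  have later: "\<exists>l\<in>{1..p}. i < l \<and> x \<in> B l"
    if A: "coarse_ranking n p ns A" and B: "coarse_ranking n p ns B"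
      and eq: "\<And>j. j \<in> {1..p} \<Longrightarrow> j < i \<Longrightarrow> A j = B j" and x: "x \<in> A i" "x \<notin> B i" for A B x
  proof -
    have "x \<in> {1..n}" using coarse_ranking_subset[OF A i(1)] x by blast
    then obtain l where l: "l \<in> {1..p}" "x \<in> B l" using B unfolding coarse_ranking_def by blast
    have "\<not> l < i"
    proof
      assume "l < i"
      moreover from this have "A l \<inter> A i = {}"
        using A l i by (simp add: coarse_ranking_def disjoint_family_on_def)
      ultimately show False using eq[of l] l x by blast
    qed
    then show ?thesis using l x by (metis linorder_neqE_nat)
  qed
  obtain l where l: "l \<in> {1..p}" "i < l" "s \<in> J l"
    using later[OF I J below s] by blast
  obtain j where j: "j \<in> {1..p}" "i < j" "t \<in> I j"
    using later[OF J I below[symmetric] t] by blast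
  show thesis using that[OF i(1) j(1,2) s(1) j(3) t(1)] l by blast
qed

lemma coarse_ranking_unique_block:
  assumes "coarse_ranking n p ns I" "i \<in> {1..p}" "j \<in> {1..p}" "x \<in> I i"
  shows "x \<in> I j \<longleftrightarrow> j = i"
proof (cases "j = i")
  case False
  then have "I i \<inter> I j = {}"
    using assms by (simp add: coarse_ranking_def disjoint_family_on_def)
  then show ?thesis using assms False by blast
qed (use assms in simp)

text \<open>
  Each exchange puts \<open>t\<close> into its block of \<open>J\<close> for good and moves otherwise only the already
  misplaced \<open>s\<close>, so that the number of misplaced indices decreases.
\<close>

lemma coarse_ranking_transpose_induct:
  fixes V :: "(nat \<Rightarrow> nat set) \<Rightarrow> 'v::order"
  assumes J: "coarse_ranking n p ns J" and \<mu>: "block_decreasing p J \<mu>"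
    and cong: "\<And>I. (\<And>j. j \<in> {1..p} \<Longrightarrow> I j = J j) \<Longrightarrow> V I = V J"
    and step: "\<And>I i j s t. coarse_ranking n p ns I \<Longrightarrow> i \<in> {1..p} \<Longrightarrow> j \<in> {1..p} \<Longrightarrow> i < j \<Longrightarrow>
       s \<in> I i \<Longrightarrow> t \<in> I j \<Longrightarrow> \<mu> s \<le> (\<mu> t :: real) \<Longrightarrow>
       V I \<le> V (\<lambda>k. Transposition.transpose s t ` I k)"
    and I: "coarse_ranking n p ns I"
  shows "V I \<le> V J"
proof -
  define D where "D I = {x \<in> {1..n}. \<exists>j\<in>{1..p}. (x \<in> I j) \<noteq> (x \<in> J j)}" for I :: "nat \<Rightarrow> nat set"
  have finD: "finite (D I)" for I by (simp add: D_def)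
  show ?thesis using I
  proof (induction "card (D I)" arbitrary: I rule: less_induct)
    case less
    show ?case
    proof (cases "\<exists>j\<in>{1..p}. I j \<noteq> J j")
      case True
      obtain i j l s t where ij: "i \<in> {1..p}" "j \<in> {1..p}" "i < j" "s \<in> I i" "t \<in> I j" "t \<in> J i"
        and l: "l \<in> {1..p}" "i < l" "s \<in> J l"
        using coarse_ranking_misplaced_pair[OF less.prems J True] by metis
      let ?\<tau> = "Transposition.transpose s t"
      let ?I = "\<lambda>k. ?\<tau> ` I k"
      have st: "s \<in> {1..n}" "t \<in> {1..n}" using coarse_ranking_subset[OF less.prems] ij by blast+
      have mem: "x \<in> ?I k \<longleftrightarrow> ?\<tau> x \<in> I k" for x k
        by (rule in_transpose_image_iff)
      have uniq: "s \<in> I k \<longleftrightarrow> k = i" "t \<in> I k \<longleftrightarrow> k = j" "t \<in> J k \<longleftrightarrow> k = i" "s \<in> J k \<longleftrightarrow> k = l"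
        if "k \<in> {1..p}" for k
        using coarse_ranking_unique_block[OF less.prems _ that]
          coarse_ranking_unique_block[OF J _ that] ij l by blast+
      have "t \<notin> D ?I" by (auto simp: D_def mem uniq)
      moreover have "s \<in> D I" "t \<in> D I"
        using st ij(1-3) l(1,2) by (auto simp: D_def uniq intro!: bexI[of _ i])
      moreover have "x \<in> D I" if "x \<in> D ?I" "x \<noteq> s" "x \<noteq> t" for x
        using that by (simp add: D_def mem)
      ultimately have "D ?I \<subset> D I" by blast
      then have "card (D ?I) < card (D I)" by (rule psubset_card_mono[OF finD])
      moreover have "coarse_ranking n p ns ?I"
        by (intro coarse_ranking_permute less.prems permutes_swap_id st)
      ultimately have "V ?I \<le> V J" by (rule less.hyps)
      \<comment> \<open>In \<open>J\<close> the index \<open>t\<close> belongs to block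
        \<open>i\<close>, which precedes the block \<open>l\<close> of \<open>s\<close>.\<close>
      moreover have "\<mu> s \<le> \<mu> t"
        using \<mu> ij l unfolding block_decreasing_def by blast
      then have "V I \<le> V ?I" by (rule step[OF less.prems ij(1-5)])
      ultimately show ?thesis by order
    next
      case False
      \<comment> \<open>The two functions agree on \<open>{1..p}\<close> but may differ elsewhere,
        so equality of the values needs \<open>cong\<close>.\<close>
      then show ?thesis using cong[of I] by simp
    qed
  qed
qed

theorem theorem2:
  fixes n p :: nat and ns :: "nat \<Rightarrow> nat"
    and \<rho> :: "real measure" and c b :: "real \<Rightarrow> real" and \<Theta> :: "real set"
    and M :: "'a measure" and X :: "nat \<Rightarrow> 'a \<Rightarrow> real"
    and \<theta> \<mu> :: "nat \<Rightarrow> real" and \<pi> :: "nat \<Rightarrow> nat"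
    and U :: "real \<Rightarrow> real" and I :: "nat \<Rightarrow> nat set"
  assumes "n \<ge> 2"
    and "regular_exp_family \<rho> c \<Theta> b"
    and "prob_space M"
    and "prob_space.indep_vars M (\<lambda>_. borel) X {1..n}"
    and "\<And>i. i \<in> {1..n} \<Longrightarrow> \<theta> i \<in> \<Theta>"
    and "\<And>i. i \<in> {1..n} \<Longrightarrow> distr M borel (X i) = exp_family_law \<rho> c b (\<theta> i)"
    and "\<And>i. i \<in> {1..n} \<Longrightarrow> \<mu> i = prob_space.expectation M (X i)"
    and "\<pi> permutes {1..n}"
    and "\<And>i j. 1 \<le> i \<Longrightarrow> i \<le> j \<Longrightarrow> j \<le> n \<Longrightarrow> \<mu> (\<pi> i) \<ge> \<mu> (\<pi> j)"
    and "\<And>j. j \<in> {1..p} \<Longrightarrow> ns j > 0"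
    and "(\<Sum>j=1..p. ns j) = n"
    and "mono U"
    and "convex_on UNIV U"
    and "coarse_ranking n p ns I"
  shows "Util M n p X U (consecutive_blocks ns \<pi>) \<ge> Util M n p X U I"
proof (rule coarse_ranking_transpose_induct[OF _ _ _ _ \<open>coarse_ranking n p ns I\<close>,
      where V = "Util M n p X U" and \<mu> = \<mu>])
  interpret E: regular_exp_family \<rho> c \<Theta> b by fact
  interpret prob_space M by fact
  have n: "1 \<in> {1..n}" "n > 0" using \<open>n \<ge> 2\<close> by auto
  \<comment> \<open>Outside \<open>{1..n}\<close> the parameter \<open>\<theta> 1\<close> is filled
    in, so that every \<open>P i\<close> is a probability measure, as the product lemmas
    require.\<close>
  define P where "P i = exp_family_law \<rho> c b (if i \<in> {1..n} then \<theta> i else \<theta> 1)" for i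
  have P: "prob_space (P i)" "sets (P i) = sets borel" for i
    unfolding P_def using assms(5) n(1) by (auto intro!: E.prob_law simp: E.sets_exp_family_law)
  have Util: "Util M n p X U I = ext_expectation (Pi\<^sub>M {1..n} P) (lse_utility n p U I)"
    if "coarse_ranking n p ns I" for I
    using assms(6) by (intro Util_eq_PiM[OF that assms(13,3) n(2) assms(4)]) (simp add: P_def)
  have mean: "\<mu> i = deriv b (\<theta> i)" if "i \<in> {1..n}" for i
  proof -
    have "X i \<in> borel_measurable M" using assms(4) that by (simp add: indep_vars_def)
    then have "\<mu> i = (\<integral>x. x \<partial>distr M borel (X i))"
      by (subst integral_distr) (auto simp: assms(7)[OF that])
    then show ?thesis using assms(6)[OF that] E.exp_family_law_mean(2)[OF assms(5)[OF that]] by simp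
  qed
  show "coarse_ranking n p ns (consecutive_blocks ns \<pi>)"
    by (rule coarse_ranking_consecutive_blocks[OF assms(8,11)])
  show "block_decreasing p (consecutive_blocks ns \<pi>) \<mu>"
    by (rule block_decreasing_consecutive_blocks[where \<pi> = \<pi>, OF assms(11)]) (rule assms(9))
  show "Util M n p X U I = Util M n p X U (consecutive_blocks ns \<pi>)"
    if "\<And>j. j \<in> {1..p} \<Longrightarrow> I j = consecutive_blocks ns \<pi> j" for I
    unfolding Util_def
    using constrained_lse_cong[of n _ _ p I "consecutive_blocks ns \<pi>", OF refl that] by simp
  fix I i j s t
  assume I: "coarse_ranking n p ns I" and ij: "i \<in> {1..p}" "j \<in> {1..p}" "i < j" "s \<in> I i" "t \<in> I j"
    and le: "\<mu> s \<le> \<mu> t"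
  let ?\<tau> = "Transposition.transpose s t"
  have st: "s \<in> {1..n}" "t \<in> {1..n}" using coarse_ranking_subset[OF I] ij by blast+
  have "s \<noteq> t" using coarse_ranking_unique_block[OF I ij(1,2,4)] ij by auto
  \<comment> \<open>Otherwise strict monotonicity of \<open>deriv b\<close> would give
    \<open>\<mu> t < \<mu> s\<close>.\<close>
  have "\<theta> s \<le> \<theta> t"
    using E.deriv_logpart_strict_mono[OF assms(5)[OF st(2)] assms(5)[OF st(1)]] le
    unfolding mean[OF st(1)] mean[OF st(2)] by linarith
  \<comment> \<open>The density of \<open>P t\<close> with respect to \<open>P s\<close>; its
    exponent has the nonnegative slope \<open>\<theta> t - \<theta> s\<close>.\<close>
  define L where "L x = ennreal (exp ((\<theta> t - \<theta> s) * x - (b (\<theta> t) - b (\<theta> s))))" for x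
  have "mono L"
    unfolding L_def using \<open>\<theta> s \<le> \<theta> t\<close>
    by (intro monoI ennreal_leI) (auto intro: mult_left_mono)
  have PL: "P t = density (P s) L"
    unfolding P_def L_def[abs_def] using st E.exp_family_law_density[of "\<theta> t" "\<theta> s"] by simp
  have "L \<in> borel_measurable borel" unfolding L_def[abs_def] by measurable
  then have "ext_expectation (Pi\<^sub>M {1..n} P) (lse_utility n p U I)
      \<le> ext_expectation (Pi\<^sub>M {1..n} P) (\<lambda>x. lse_utility n p U I (x \<circ> ?\<tau>))"
    by (intro PiM_transpose_ext_expectation_le[where L = L] P st \<open>s \<noteq> t\<close> \<open>mono L\<close> PL
        borel_measurable_lse_utility[OF I assms(13)] lse_utility_transpose_le[OF I assms(13) ij]) auto
  also have "(\<lambda>x. lse_utility n p U I (x \<circ> ?\<tau>)) = lse_utility n p U (\<lambda>k. ?\<tau> ` I k)"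
    by (intro ext lse_utility_permute[OF I, symmetric] permutes_swap_id st)
  finally show "Util M n p X U I \<le> Util M n p X U (\<lambda>k. ?\<tau> ` I k)"
    unfolding Util[OF I] Util[OF coarse_ranking_permute[OF I permutes_swap_id[OF st]]] .
qed

end
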